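(* Let $0<a<b$ be real numbers, let $\mathcal{I}=\{z\in\mathbb{C}:|z|\le a\}$ and $\mathcal{O}=\{z\in\mathbb{C}:|z|\ge b\}$, and let $k$ be a positive integer. The $k$-point trapezoidal quadrature discretization of the contour integral $\frac{1}{2\pi\imath}\oint_{\Gamma}\frac{1}{\zeta-z}\,\mathrm{d}\zeta$ on the circle $\Gamma=\{\zeta\in\mathbb{C}:|\zeta|=a\}$ (the boundary of $\mathcal{I}$) results in the rational function $$R_{0,a,k}(z)=\frac{1}{1+\left(\frac{z}{a}\right)^k}.$$ The spectrum separation of the trapezoidal quadrature is $$\frac{\sup_{z\in\mathcal{O}}|R_{0,a,k}(z)|}{\inf_{z\in\mathcal{I}}|R_{0,a,k}(z)|}=\frac{2}{\left(\frac{b}{a}\right)^k-1},$$ which achieves the same decay rate (with respect to $k$) as the infimum $$Z_k(\mathcal{O},\mathcal{I})=\inf_{r\in\mathcal{R}_{k,k}}\frac{\sup_{z\in\mathcal{O}}|r(z)|}{\inf_{z\in\mathcal{I}}|r(z)|}.$$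
   Context: For $c\in\mathbb{C}$, $r>0$ and a positive integer $k$, the $k$-th order (i.e. $k$-point) trapezoidal quadrature of $\frac{1}{2\pi\imath}\oint_{|\zeta-c|=r}\frac{1}{\zeta-z}\,\mathrm{d}\zeta$ (positively oriented circle) is the rational function $R_{c,r,k}(z)=\sum_{i=1}^k\frac{w_i^{(k)}}{p_i^{(k)}-z}$ with poles $p_i^{(k)}=re^{\imath\theta_i^{(k)}}+c$, weights $w_i^{(k)}=re^{\imath\theta_i^{(k)}}/k$, and $\theta_i^{(k)}=(2i-1)\pi/k$, $i=1,\dots,k$. The spectrum separation of a rational function $R$ is the ratio $\sup_{z\in\mathcal{O}}|R(z)|\big/\inf_{z\in\mathcal{I}}|R(z)|$. $\mathcal{R}_{k,k}$ denotes the set of rational functions $P(z)/Q(z)$ with polynomials $P,Q$ of degree at most $k$; the infimum $Z_k(\mathcal{O},\mathcal{I})$ is the value of Zolotarev's third problem for the pair $(\mathcal{O},\mathcal{I})$. Conventions: $|r(z)|=+\infty$ at a pole $z$ of a rational function $r$; $r\equiv 0$ is excluded from the infimum; the quotient is $+\infty$ if its numerator is $+\infty$ or its denominator is $0$. *)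

theory Defs
  imports
    "HOL-Computational_Algebra.Polynomial_Factorial"
    "HOL-Computational_Algebra.Field_as_Ring"
    "HOL-Analysis.Analysis"
    "HOL-Library.Landau_Symbols"
begin

text \<open>
  Rational functions over the complex numbers are elements of the fraction field
  \<^typ>\<open>complex poly fract\<close>, so that they have well-defined poles.
\<close>

type_synonym ratfun = "complex poly fract"

definition ratfun_const :: "complex \<Rightarrow> ratfun" where
  "ratfun_const c = to_fract [:c:]"

definition ratfun_var :: ratfun where
  "ratfun_var = to_fract [:0, 1:]"

text \<open>
  The modulus of the value at a point, with value \<open>\<infinity>\<close> at the poles. The pair
  \<^term>\<open>quot_of_fract r\<close> is the representation of \<open>r\<close> in lowest terms, so
  the poles are exactly the zeros of its denominator.
\<close>

definition ratfun_cmod :: "ratfun \<Rightarrow> complex \<Rightarrow> ennreal" where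
  "ratfun_cmod r z =
     (let (P, Q) = quot_of_fract r
      in if poly Q z = 0 then \<infinity> else ennreal (cmod (poly P z / poly Q z)))"

definition ratfuns :: "nat \<Rightarrow> nat \<Rightarrow> ratfun set" where
  "ratfuns m n = {to_fract P / to_fract Q | P Q. Q \<noteq> 0 \<and> degree P \<le> m \<and> degree Q \<le> n}"

definition trapz_angle :: "nat \<Rightarrow> nat \<Rightarrow> real" where
  "trapz_angle k i = (2 * real i - 1) * pi / real k"

definition trapz_pole :: "complex \<Rightarrow> real \<Rightarrow> nat \<Rightarrow> nat \<Rightarrow> complex" where
  "trapz_pole c r k i = complex_of_real r * cis (trapz_angle k i) + c"

definition trapz_weight :: "real \<Rightarrow> nat \<Rightarrow> nat \<Rightarrow> complex" where
  "trapz_weight r k i = complex_of_real r * cis (trapz_angle k i) / of_nat k"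

definition trapz_ratfun :: "complex \<Rightarrow> real \<Rightarrow> nat \<Rightarrow> ratfun" where
  "trapz_ratfun c r k =
     (\<Sum>i = 1..k. ratfun_const (trapz_weight r k i) /
                   (ratfun_const (trapz_pole c r k i) - ratfun_var))"

text \<open>
  The case distinction is needed because \<open>\<infinity> / \<infinity> = 0\<close> and \<open>0 / 0 = 0\<close> in
  \<^typ>\<open>ennreal\<close>.
\<close>

definition spectrum_separation :: "complex set \<Rightarrow> complex set \<Rightarrow> ratfun \<Rightarrow> ennreal" where
  "spectrum_separation Out Inn r =
     (let S = (SUP z\<in>Out. ratfun_cmod r z); D = (INF z\<in>Inn. ratfun_cmod r z)
      in if S = \<infinity> \<or> D = 0 then \<infinity> else S / D)"

definition zolotarev :: "nat \<Rightarrow> complex set \<Rightarrow> complex set \<Rightarrow> ennreal" where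
  "zolotarev k Out Inn = (INF r\<in>ratfuns k k - {0}. spectrum_separation Out Inn r)"

end

theory Submission
  imports
    Defs
    "HOL-Computational_Algebra.Fundamental_Theorem_Algebra"
    "HOL-Complex_Analysis.Conformal_Mappings"
begin

text \<open>
  Write \<open>u\<^sub>i = cis \<theta>\<^sub>i\<close> for the nodes, so that \<open>u\<^sub>i ^ k = -1\<close>, and \<open>y = z / a\<close>. The \<open>i\<close>-th summand
  of the quadrature is \<open>1 / (k (1 - y / u\<^sub>i))\<close>, which a finite geometric series turns into
  \<open>(\<Sum>m<k. (y / u\<^sub>i) ^ m) / (k (1 + y ^ k))\<close>; summing over \<open>i\<close> only leaves the term \<open>m = 0\<close>.

  The decay rate is optimal because \<open>(a / b) ^ k\<close> is a lower bound for the Zolotarev number.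
  Let \<open>r = P / Q\<close> be in lowest terms with \<open>\<bar>r\<bar> \<le> s\<close> on the outer set and \<open>\<bar>r\<bar> \<ge> d > 0\<close> on the inner
  one. Reflecting the zeros of \<open>Q\<close> in a circle about the origin does not change \<open>\<bar>Q\<bar>\<close> on that
  circle. Reflecting those in the disc of radius \<open>a\<close> out of it and applying the maximum principle
  to \<open>Q / P\<close> gives \<open>d a ^ n \<bar>q\<bar> \<le> \<bar>P 0\<bar>\<close>, where \<open>n\<close> is the degree of \<open>Q\<close> and \<open>q\<close> its leading
  coefficient; reflecting all of them out of the disc of radius \<open>b\<close> and applying the maximum
  principle to \<open>P / Q\<close> gives \<open>\<bar>P 0\<bar> \<le> s b ^ n \<bar>q\<bar>\<close>.
\<close>

section \<open>Rational functions\<close>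

lemma to_fract_power [simp]: "to_fract (x ^ n) = to_fract x ^ n"
  by (induction n) simp_all

lemma ratfun_const_0 [simp]: "ratfun_const 0 = 0"
  and ratfun_const_1 [simp]: "ratfun_const 1 = 1"
  by (simp_all add: ratfun_const_def flip: one_pCons)

lemma ratfun_const_eq_0_iff [simp]: "ratfun_const c = 0 \<longleftrightarrow> c = 0"
  by (simp add: ratfun_const_def)

lemma ratfun_const_add: "ratfun_const (c + d) = ratfun_const c + ratfun_const d"
  by (simp add: ratfun_const_def flip: to_fract_add)

lemma ratfun_const_minus: "ratfun_const (- c) = - ratfun_const c"
  by (simp add: ratfun_const_def flip: to_fract_uminus)

lemma ratfun_const_mult: "ratfun_const (c * d) = ratfun_const c * ratfun_const d"
  by (simp add: ratfun_const_def flip: to_fract_mult)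

lemma ratfun_const_divide: "ratfun_const (c / d) = ratfun_const c / ratfun_const d"
proof (cases "d = 0")
  case False
  then have "ratfun_const (c / d) * ratfun_const d = ratfun_const c"
    by (simp flip: ratfun_const_mult)
  with False show ?thesis
    by (simp add: field_simps)
qed simp

lemma ratfun_const_power: "ratfun_const (c ^ n) = ratfun_const c ^ n"
  by (induction n) (simp_all add: ratfun_const_mult)

lemma ratfun_const_sum: "ratfun_const (sum f A) = (\<Sum>x\<in>A. ratfun_const (f x))"
  by (induction A rule: infinite_finite_induct) (simp_all add: ratfun_const_add)

text \<open>Relates an arbitrary representation to the one in lowest terms that
  \<open>ratfun_cmod\<close> evaluates. Being free of division, the identity can also be evaluated
  at zeros of the denominators.\<close>

lemma quot_of_fract_cross_mult:
  assumes "Q \<noteq> 0"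
  shows "P * snd (quot_of_fract (to_fract P / to_fract Q)) =
         fst (quot_of_fract (to_fract P / to_fract Q)) * (Q :: complex poly)"
proof -
  let ?r = "to_fract P / to_fract Q"
  have "to_fract (fst (quot_of_fract ?r)) / to_fract (snd (quot_of_fract ?r)) = ?r"
    by (simp flip: Fract_conv_to_fract)
  then have "to_fract (P * snd (quot_of_fract ?r)) = to_fract (fst (quot_of_fract ?r) * Q)"
    using assms by (simp add: field_simps)
  then show ?thesis
    by (simp only: to_fract_eq_iff)
qed

lemma coprime_poly_no_common_root:
  assumes "coprime P (Q :: complex poly)" "poly P z = 0"
  shows "poly Q z \<noteq> 0"
proof
  assume "poly Q z = 0"
  with assms have "is_unit [:- z, 1:]"
    by (metis coprime_common_divisor poly_eq_0_iff_dvd)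
  then show False
    by (simp add: is_unit_poly_iff)
qed

text \<open>At a zero of the reduced denominator, the cross-multiplied identity would make the
  reduced numerator vanish as well, against coprimality.\<close>

lemma ratfun_cmod_divide:
  assumes "poly Q z \<noteq> 0"
  shows "ratfun_cmod (to_fract P / to_fract Q) z = ennreal (cmod (poly P z / poly Q z))"
proof -
  let ?r = "to_fract P / to_fract Q"
  obtain P' Q' where eq: "quot_of_fract ?r = (P', Q')"
    by force
  have "Q \<noteq> 0"
    using assms by auto
  from quot_of_fract_cross_mult[OF this, of P] have "P * Q' = P' * Q"
    by (simp add: eq)
  then have *: "poly P z * poly Q' z = poly P' z * poly Q z"
    by (metis poly_mult)
  have "coprime P' Q'"
    using coprime_quot_of_fract[of ?r] by (simp add: eq)
  with * assms have "poly Q' z \<noteq> 0"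
    using coprime_poly_no_common_root[of P' Q' z] by auto
  moreover from this * assms have "poly P' z / poly Q' z = poly P z / poly Q z"
    by (simp add: field_simps)
  ultimately show ?thesis
    by (simp add: ratfun_cmod_def eq)
qed

lemma ratfun_cmod_pole:
  assumes "Q \<noteq> 0" "poly Q z = 0" "poly P z \<noteq> 0"
  shows "ratfun_cmod (to_fract P / to_fract Q) z = \<infinity>"
proof -
  obtain P' Q' where eq: "quot_of_fract (to_fract P / to_fract Q) = (P', Q')"
    by force
  from quot_of_fract_cross_mult[OF assms(1), of P] have "P * Q' = P' * Q"
    by (simp add: eq)
  then have "poly P z * poly Q' z = 0"
    by (metis poly_mult assms(2) mult_zero_right)
  with assms show ?thesis
    by (simp add: ratfun_cmod_def eq)
qed

text \<open>The reduced denominator divides the reduced numerator times \<open>Q\<close>; being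
  coprime to the former, it divides \<open>Q\<close>.\<close>

lemma degree_snd_quot_of_fract_ratfuns:
  assumes "r \<in> ratfuns m n"
  shows "degree (snd (quot_of_fract r)) \<le> n"
proof -
  obtain P Q where r: "r = to_fract P / to_fract Q" "Q \<noteq> 0" "degree Q \<le> n"
    using assms by (auto simp: ratfuns_def)
  have "snd (quot_of_fract r) dvd fst (quot_of_fract r) * Q"
    using quot_of_fract_cross_mult[OF r(2), of P] unfolding r(1) by (metis dvd_triv_right)
  then have "snd (quot_of_fract r) dvd Q"
    using coprime_quot_of_fract[of r] coprime_commute coprime_dvd_mult_right_iff by blast
  with r show ?thesis
    using dvd_imp_degree_le le_trans by blast
qed

section \<open>The trapezoidal quadrature\<close>

lemma cis_trapz_angle_power:
  assumes "k > 0"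
  shows "cis (trapz_angle k i) ^ k = -1"
proof -
  have "cis (trapz_angle k i) ^ k = cis (of_int (2 * int i - 1) * pi)"
    using assms by (simp add: Complex.DeMoivre trapz_angle_def)
  also have "\<dots> = cis (2 * pi * of_int (int i)) * cis (- pi)"
    by (simp add: cis_mult algebra_simps)
  also have "\<dots> = -1"
    by (subst cis_multiple_2pi) (auto simp: complex_eq_iff)
  finally show ?thesis .
qed

text \<open>Orthogonality of roots of unity: up to a constant factor this is a geometric sum whose
  ratio \<open>\<omega>\<close> is a \<open>k\<close>-th root of unity, different from 1 because
  \<open>k\<close> does not divide \<open>m\<close>.\<close>

lemma sum_trapz_nodes_inverse_power:
  assumes "0 < m" "m < k"
  shows "(\<Sum>i=1..k. inverse (cis (trapz_angle k i)) ^ m) = 0"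
proof -
  define \<omega> where "\<omega> = cis (- (2 * pi * real m / real k))"
  \<comment> \<open>The angles start at \<open>pi / k\<close> for index 1 and advance by
    \<open>2 * pi / k\<close>.\<close>
  have summand: "inverse (cis (trapz_angle k (Suc i))) ^ m = cis (- (real m * pi / real k)) * \<omega> ^ i" for i
    by (simp add: \<omega>_def trapz_angle_def Complex.DeMoivre cis_mult add_divide_distrib
        diff_divide_distrib algebra_simps)
  have "\<omega> ^ k = cis (2 * pi * of_int (- int m))"
    using assms by (simp add: \<omega>_def Complex.DeMoivre algebra_simps)
  also have "\<dots> = 1"
    by (rule cis_multiple_2pi) auto
  finally have "\<omega> ^ k = 1" .
  moreover have "\<omega> \<noteq> 1"
  proof
    assume "\<omega> = 1"
    then have "cis (2 * pi * real m / real k) = 1"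
      by (simp add: \<omega>_def flip: cis_inverse)
    then obtain j :: int where "2 * pi * real m / real k = of_int j * (2 * pi)"
      by (metis cos_one_2pi_int cis.sel(1) one_complex.sel(1) mult.assoc mult.commute)
    then have "real m = of_int j * real k"
      using assms by (simp add: field_simps)
    then have "int m = j * int k"
      by (metis of_int_eq_iff of_int_mult of_int_of_nat_eq)
    then have "k dvd m"
      by (metis dvd_triv_right int_dvd_int_iff)
    with assms show False
      by (auto dest: dvd_imp_le)
  qed
  ultimately have "(\<Sum>i<k. \<omega> ^ i) = 0"
    by (simp add: geometric_sum)
  have "(\<Sum>i=1..k. inverse (cis (trapz_angle k i)) ^ m)
      = (\<Sum>i<k. inverse (cis (trapz_angle k (Suc i))) ^ m)"
    by (simp add: sum.atLeast1_atMost_eq)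
  also have "\<dots> = cis (- (real m * pi / real k)) * (\<Sum>i<k. \<omega> ^ i)"
    by (simp only: summand sum_distrib_left)
  finally show ?thesis
    using \<open>(\<Sum>i<k. \<omega> ^ i) = 0\<close> by simp
qed

text \<open>Kept as a polynomial, so that its degree and its values at points are available for
  \<open>ratfuns\<close> and \<open>ratfun_cmod\<close>.\<close>

definition trapz_denom :: "real \<Rightarrow> nat \<Rightarrow> complex poly" where
  "trapz_denom a k = 1 + smult (1 / of_real a ^ k) ([:0, 1:] ^ k)"

lemma poly_trapz_denom: "poly (trapz_denom a k) z = 1 + (z / of_real a) ^ k"
  by (simp add: trapz_denom_def power_divide)

lemma trapz_denom_nonzero: "k > 0 \<Longrightarrow> trapz_denom a k \<noteq> 0"
  using poly_trapz_denom[of a k 0] by (auto simp: power_0_left)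

lemma degree_trapz_denom: "degree (trapz_denom a k) \<le> k"
  unfolding trapz_denom_def
  by (intro degree_add_le order_trans[OF degree_smult_le]) (simp_all add: degree_power_eq)

lemma to_fract_trapz_denom:
  "to_fract (trapz_denom a k) = 1 + (ratfun_var / ratfun_const (of_real a)) ^ k"
proof -
  have "trapz_denom a k = 1 + [:1 / of_real a ^ k:] * [:0, 1:] ^ k"
    by (simp add: trapz_denom_def)
  then have "to_fract (trapz_denom a k) = 1 + ratfun_const (1 / of_real a ^ k) * ratfun_var ^ k"
    by (simp only: to_fract_add to_fract_1 to_fract_mult to_fract_power ratfun_const_def ratfun_var_def)
  then show ?thesis
    by (simp add: ratfun_const_divide ratfun_const_power power_divide)
qed

lemma trapz_ratfun_centered:
  assumes "a > 0" "k > 0"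
  shows "trapz_ratfun 0 a k = 1 / to_fract (trapz_denom a k)"
proof -
  define y where "y = ratfun_var / ratfun_const (of_real a)"
  define u where "u i = cis (trapz_angle k i)" for i
  define D where "D = to_fract (trapz_denom a k)"
  have D: "D = 1 + y ^ k"
    by (simp add: D_def y_def to_fract_trapz_denom)
  have D_nz: "D \<noteq> 0"
    using trapz_denom_nonzero[OF assms(2)] by (simp add: D_def)
  have u_nz: "u i \<noteq> 0" for i
    by (simp add: u_def)
  have var: "ratfun_var = ratfun_const (of_real a) * y"
    using assms by (simp add: y_def)
  have k_nz: "ratfun_const (of_nat k) \<noteq> 0"
    using assms by simp
  have summand: "ratfun_const (trapz_weight a k i) / (ratfun_const (trapz_pole 0 a k i) - ratfun_var)
      = (\<Sum>m<k. ratfun_const (inverse (u i) ^ m) * y ^ m) / (ratfun_const (of_nat k) * D)" for i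
  proof -
    \<comment> \<open>The ratio \<open>y / u i\<close> of the geometric series.\<close>
    define x where "x = ratfun_const (inverse (u i)) * y"
    have "ratfun_const (inverse (u i)) ^ k = -1"
      using cis_trapz_angle_power[OF assms(2), of i]
      by (simp add: u_def power_inverse ratfun_const_minus del: cis_inverse flip: ratfun_const_power)
    then have "x ^ k = - (y ^ k)"
      by (simp add: x_def power_mult_distrib)
    \<comment> \<open>The sum telescopes to \<open>1 - x ^ k\<close>, which is
      \<open>1 + y ^ k\<close> for every node.\<close>
    then have geo: "(1 - x) * (\<Sum>m<k. x ^ m) = D"
      by (simp add: D flip: one_diff_power_eq)
    then have x: "1 - x \<noteq> 0"
      using D_nz by auto
    have "ratfun_const (u i) * ratfun_const (inverse (u i)) = 1"
      using u_nz by (simp flip: ratfun_const_mult)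
    then have y: "y = ratfun_const (u i) * x"
      by (simp add: x_def flip: mult.assoc)
    have "ratfun_const (trapz_pole 0 a k i) - ratfun_var
        = ratfun_const (of_real a) * ratfun_const (u i) * (1 - x)"
      by (subst var, subst y) (simp add: trapz_pole_def u_def ratfun_const_mult algebra_simps)
    moreover have "ratfun_const (trapz_weight a k i)
        = ratfun_const (of_real a) * ratfun_const (u i) / ratfun_const (of_nat k)"
      by (simp add: trapz_weight_def u_def ratfun_const_mult ratfun_const_divide)
    ultimately have "ratfun_const (trapz_weight a k i) / (ratfun_const (trapz_pole 0 a k i) - ratfun_var)
        = 1 / (ratfun_const (of_nat k) * (1 - x))"
      using assms u_nz[of i] x by simp
    also have "\<dots> = (\<Sum>m<k. x ^ m) / (ratfun_const (of_nat k) * D)"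
      using x k_nz D_nz by (simp add: divide_simps) (simp add: mult_ac flip: geo)
    finally show ?thesis
      by (simp add: x_def power_mult_distrib ratfun_const_power)
  qed
  have "(\<Sum>i=1..k. \<Sum>m<k. ratfun_const (inverse (u i) ^ m) * y ^ m)
      = (\<Sum>m<k. ratfun_const (\<Sum>i=1..k. inverse (u i) ^ m) * y ^ m)"
    by (subst sum.swap) (simp add: ratfun_const_sum sum_distrib_right)
  \<comment> \<open>Every power sum with \<open>0 < m < k\<close> vanishes; the one for
    \<open>m = 0\<close> counts the nodes.\<close>
  also have "\<dots> = (\<Sum>m<k. if m = 0 then ratfun_const (of_nat k) else 0)"
    using sum_trapz_nodes_inverse_power[of _ k]
    by (intro sum.cong refl) (auto simp: u_def simp del: cis_inverse)
  also have "\<dots> = ratfun_const (of_nat k)"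
    using assms by simp
  finally have "(\<Sum>i=1..k. \<Sum>m<k. ratfun_const (inverse (u i) ^ m) * y ^ m) = ratfun_const (of_nat k)" .
  then show ?thesis
    using k_nz by (simp add: trapz_ratfun_def summand D_def flip: sum_divide_distrib)
qed

text \<open>With \<open>w = (z / a) ^ k\<close>, the modulus of \<open>1 + w\<close> is at least
  \<open>(b / a) ^ k - 1\<close> on the outer set and at most 2 on the inner one, by the triangle
  inequality; both bounds are attained.\<close>

lemma spectrum_separation_trapz:
  assumes "0 < a" "a < b" "k > 0"
  shows "spectrum_separation {z. cmod z \<ge> b} {z. cmod z \<le> a} (trapz_ratfun 0 a k)
       = ennreal (2 / ((b / a) ^ k - 1))"
proof -
  define r where "r = trapz_ratfun 0 a k"
  define B where "B = (b / a) ^ k"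
  have r: "r = to_fract 1 / to_fract (trapz_denom a k)"
    using assms by (simp add: r_def trapz_ratfun_centered)
  have B: "B > 1"
    using assms by (simp add: B_def)
  have cmod_r: "ratfun_cmod r z = ennreal (1 / cmod (1 + (z / a) ^ k))" if "1 + (z / a) ^ k \<noteq> 0" for z :: complex
    unfolding r by (subst ratfun_cmod_divide) (use that in \<open>simp_all add: poly_trapz_denom norm_divide\<close>)
  have cmod_r_pole: "ratfun_cmod r z = \<infinity>" if "1 + (z / a) ^ k = 0" for z :: complex
    unfolding r by (rule ratfun_cmod_pole)
      (use that assms in \<open>simp_all add: poly_trapz_denom trapz_denom_nonzero\<close>)
  have sup: "(SUP z\<in>{z. cmod z \<ge> b}. ratfun_cmod r z) = ennreal (1 / (B - 1))"
  proof (rule SUP_eqI)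
    fix z :: complex assume "z \<in> {z. cmod z \<ge> b}"
    then have "B \<le> cmod ((z / a) ^ k)"
      using assms by (auto simp: B_def norm_power norm_divide intro!: power_mono divide_right_mono)
    then have *: "B - 1 \<le> cmod (1 + (z / a) ^ k)"
      using norm_diff_ineq[of "(z / a) ^ k" 1] by (simp add: add.commute)
    with B have "1 + (z / a) ^ k \<noteq> 0"
      by auto
    then show "ratfun_cmod r z \<le> ennreal (1 / (B - 1))"
      using * B by (auto simp: cmod_r intro!: ennreal_leI divide_left_mono mult_pos_pos)
  next
    fix y assume y: "\<And>z. z \<in> {z. cmod z \<ge> b} \<Longrightarrow> ratfun_cmod r z \<le> y"
    \<comment> \<open>At this angle \<open>(z / a) ^ k\<close> is the negative real
      \<open>- B\<close>, the equality case of the reverse triangle inequality.\<close>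
    define z where "z = b * cis (trapz_angle k 1)"
    have "(z / a) ^ k = - complex_of_real B"
      using cis_trapz_angle_power[OF assms(3), of 1]
      by (simp add: z_def B_def power_mult_distrib power_divide)
    then have "1 + (z / a) ^ k = complex_of_real (1 - B)"
      by simp
    moreover from this have "cmod (1 + (z / a) ^ k) = B - 1"
      using B by (simp only: norm_of_real)
    ultimately have "ratfun_cmod r z = ennreal (1 / (B - 1))"
      using B by (subst cmod_r) auto
    moreover have "ratfun_cmod r z \<le> y"
      using assms by (intro y) (simp add: z_def norm_mult)
    ultimately show "ennreal (1 / (B - 1)) \<le> y"
      by simp
  qed
  have inf: "(INF z\<in>{z. cmod z \<le> a}. ratfun_cmod r z) = ennreal (1 / 2)"
  proof (rule INF_eqI)
    fix z :: complex assume z: "z \<in> {z. cmod z \<le> a}"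
    show "ennreal (1 / 2) \<le> ratfun_cmod r z"
    \<comment> \<open>The poles have modulus \<open>a\<close> and so lie in the inner set; the value
      there is infinite and the bound trivial.\<close>
    proof (cases "1 + (z / a) ^ k = 0")
      case False
      have "cmod ((z / a) ^ k) \<le> 1"
        using z assms by (auto simp: norm_power norm_divide intro!: power_le_one)
      then have "cmod (1 + (z / a) ^ k) \<le> 2"
        using norm_triangle_ineq[of 1 "(z / a) ^ k"] by simp
      with False show ?thesis
        by (auto simp: cmod_r simp del: ennreal_half intro!: ennreal_leI divide_left_mono)
    qed (simp add: cmod_r_pole)
  next
    fix y assume y: "\<And>z. z \<in> {z. cmod z \<le> a} \<Longrightarrow> y \<le> ratfun_cmod r z"
    \<comment> \<open>At \<open>z = a\<close> the denominator is exactly 2.\<close>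
    have "y \<le> ratfun_cmod r (of_real a)"
      using assms by (intro y) simp
    then show "y \<le> ennreal (1 / 2)"
      using assms by (simp add: cmod_r)
  qed
  have "spectrum_separation {z. cmod z \<ge> b} {z. cmod z \<le> a} r
      = ennreal (1 / (B - 1)) / ennreal (1 / 2)"
    unfolding spectrum_separation_def sup inf by (simp add: Let_def ennreal_eq_0_iff del: ennreal_half)
  also have "\<dots> = ennreal (2 / (B - 1))"
    using B by (subst divide_ennreal) (auto simp: field_simps)
  finally show ?thesis
    by (simp add: r_def B_def)
qed

section \<open>The lower bound for the Zolotarev number\<close>

text \<open>Maximum principle for \<open>f / g\<close> on the disc. It serves twice: with
  \<open>P\<close> as \<open>g\<close>, and with the reflected \<open>Q\<close> as
  \<open>g\<close>.\<close>

lemma norm_le_at_0_of_sphere: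
  assumes "f holomorphic_on UNIV" "g holomorphic_on UNIV" "\<rho> > 0"
    and "\<And>z. cmod z \<le> \<rho> \<Longrightarrow> g z \<noteq> 0"
    and "\<And>z. cmod z = \<rho> \<Longrightarrow> cmod (f z) \<le> M * cmod (g z)"
  shows "cmod (f 0) \<le> M * cmod (g 0)"
proof -
  have hol: "(\<lambda>z. f z / g z) holomorphic_on cball 0 \<rho>"
    using assms by (intro holomorphic_on_divide) (auto intro: holomorphic_on_subset)
  have "cmod (f 0 / g 0) \<le> M"
  proof (rule maximum_modulus_frontier[of "\<lambda>z. f z / g z" "cball 0 \<rho>"])
    show "(\<lambda>z. f z / g z) holomorphic_on interior (cball 0 \<rho>)"
      using hol interior_subset holomorphic_on_subset by blast
    show "continuous_on (closure (cball 0 \<rho>)) (\<lambda>z. f z / g z)"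
      using hol by (simp add: holomorphic_on_imp_continuous_on)
    show "cmod (f z / g z) \<le> M" if "z \<in> frontier (cball 0 \<rho>)" for z
      using that assms(4,5)[of z] \<open>\<rho> > 0\<close> by (auto simp: norm_divide divide_simps)
  qed (use \<open>\<rho> > 0\<close> in auto)
  with assms(3) assms(4)[of 0] show ?thesis
    by (simp add: norm_divide divide_simps)
qed

text \<open>On the circle \<open>\<rho> * \<rho> = z * cnj z\<close>, so the left factor is
  \<open>z / \<rho>\<close> times \<open>cnj (z - q)\<close>. For \<open>q \<noteq> 0\<close> its
  zero is the mirror image of \<open>q\<close> in the circle; for \<open>q = 0\<close> it is
  constant.\<close>

lemma cmod_reflected_linear_factor:
  assumes "cmod z = \<rho>" "\<rho> > 0"
  shows "cmod (of_real \<rho> - cnj q * z / of_real \<rho>) = cmod (z - q)"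
proof -
  have "complex_of_real \<rho> * of_real \<rho> = z * cnj z"
    using assms complex_norm_square[of z] by (simp add: power2_eq_square)
  then have "of_real \<rho> - cnj q * z / of_real \<rho> = z / of_real \<rho> * cnj (z - q)"
    using assms by (simp add: field_simps)
  moreover have "cmod (z / of_real \<rho> * cnj (z - q)) = cmod (z / of_real \<rho>) * cmod (z - q)"
    by (simp only: norm_mult complex_mod_cnj)
  ultimately show ?thesis
    using assms by (simp add: norm_divide)
qed

lemma annulus_ratio_bound:
  fixes P Q :: "complex poly"
  assumes "0 < a" "0 < b" "0 \<le> d"
    and P_nz: "\<And>z. cmod z \<le> a \<Longrightarrow> poly P z \<noteq> 0"
    and inner: "\<And>z. cmod z \<le> a \<Longrightarrow> d * cmod (poly Q z) \<le> cmod (poly P z)"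
    and Q_nz: "\<And>z. cmod z \<ge> b \<Longrightarrow> poly Q z \<noteq> 0"
    and outer: "\<And>z. cmod z \<ge> b \<Longrightarrow> cmod (poly P z) \<le> s * cmod (poly Q z)"
  shows "d * a ^ degree Q \<le> s * b ^ degree Q"
proof -
  define n where "n = degree Q"
  define c where "c = lead_coeff Q"
  obtain q where q: "smult c (\<Prod>i<n. [:- q i, 1:]) = Q"
    unfolding n_def c_def using complex_poly_decompose'[of Q] by blast
  have Q: "poly Q z = c * (\<Prod>i<n. z - q i)" for z
    by (subst q[symmetric]) (simp add: poly_prod)
  have "poly Q (of_real b) \<noteq> 0"
    using assms by (intro Q_nz) simp
  then have c: "c \<noteq> 0"
    by (auto simp: Q)
  have q_less: "cmod (q i) < b" if "i < n" for i
    using Q_nz[of "q i"] that by (force simp: Q)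
  \<comment> \<open>At 0 a reflected factor has modulus equal to the radius. Reflecting only the
    zeros inside radius \<open>a\<close> thus makes each \<open>f i 0\<close> at least
    \<open>a\<close> in modulus, while each \<open>g i 0\<close> has modulus exactly
    \<open>b\<close>.\<close>
  define f where "f i z = (if cmod (q i) < a then of_real a - cnj (q i) * z / of_real a else z - q i)" for i z
  define g where "g i z = of_real b - cnj (q i) * z / of_real b" for i z
  have f_hol: "f i holomorphic_on UNIV" for i
    unfolding f_def by (cases "cmod (q i) < a") (use assms in \<open>auto intro!: holomorphic_intros\<close>)
  have g_hol: "g i holomorphic_on UNIV" for i
    unfolding g_def using assms by (auto intro!: holomorphic_intros)
  have "cmod (of_real d * c * (\<Prod>i<n. f i 0)) \<le> 1 * cmod (poly P 0)"
  proof (rule norm_le_at_0_of_sphere[of "\<lambda>z. of_real d * c * (\<Prod>i<n. f i z)"])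
    show "(\<lambda>z. of_real d * c * (\<Prod>i<n. f i z)) holomorphic_on UNIV"
      by (intro holomorphic_intros f_hol)
    fix z assume z: "cmod z = a"
    have "cmod (f i z) = cmod (z - q i)" for i
      using cmod_reflected_linear_factor[OF z] assms by (simp add: f_def)
    then have "cmod (of_real d * c * (\<Prod>i<n. f i z)) = d * cmod (poly Q z)"
      using assms by (simp add: Q norm_mult prod_norm[symmetric])
    then show "cmod (of_real d * c * (\<Prod>i<n. f i z)) \<le> 1 * cmod (poly P z)"
      using inner[of z] z by simp
  qed (use assms in \<open>auto intro!: holomorphic_intros\<close>)
  then have "d * cmod c * (\<Prod>i<n. cmod (f i 0)) \<le> cmod (poly P 0)"
    using assms by (simp add: norm_mult prod_norm[symmetric])
  moreover have "a ^ n \<le> (\<Prod>i<n. cmod (f i 0))"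
    using prod_mono[of "{..<n}" "\<lambda>_. a" "\<lambda>i. cmod (f i 0)"] assms by (auto simp: f_def)
  then have "d * cmod c * a ^ n \<le> d * cmod c * (\<Prod>i<n. cmod (f i 0))"
    using assms by (intro mult_left_mono) auto
  moreover have "cmod (poly P 0) \<le> s * cmod (c * (\<Prod>i<n. g i 0))"
  proof (rule norm_le_at_0_of_sphere[of "poly P" "\<lambda>z. c * (\<Prod>i<n. g i z)"])
    show "(\<lambda>z. c * (\<Prod>i<n. g i z)) holomorphic_on UNIV"
      by (intro holomorphic_intros g_hol)
    fix z
    show "c * (\<Prod>i<n. g i z) \<noteq> 0" if z: "cmod z \<le> b"
    proof -
      \<comment> \<open>Since \<open>q i\<close> lies inside radius \<open>b\<close>, its mirror
        image lies strictly outside.\<close>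
      have "g i z \<noteq> 0" if "i < n" for i
      proof
        assume "g i z = 0"
        then have "cnj (q i) * z = of_real b * of_real b"
          using assms by (simp add: g_def field_simps)
        then have "cmod (q i) * cmod z = b * b"
          using assms by (metis norm_mult complex_mod_cnj norm_of_real abs_of_pos)
        moreover have "cmod (q i) * cmod z \<le> cmod (q i) * b"
          using z by (intro mult_left_mono) auto
        moreover have "cmod (q i) * b < b * b"
          using q_less[OF that] assms by simp
        ultimately show False
          by simp
      qed
      with c show ?thesis
        by simp
    qed
    assume z: "cmod z = b"
    have "cmod (g i z) = cmod (z - q i)" for i
      using cmod_reflected_linear_factor[OF z] assms by (simp add: g_def)
    then have "cmod (c * (\<Prod>i<n. g i z)) = cmod (poly Q z)"
      by (simp add: Q norm_mult prod_norm[symmetric])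
    then show "cmod (poly P z) \<le> s * cmod (c * (\<Prod>i<n. g i z))"
      using outer[of z] z by simp
  qed (use assms in \<open>auto intro!: holomorphic_intros\<close>)
  then have "cmod (poly P 0) \<le> s * cmod c * b ^ n"
    using assms by (simp add: g_def norm_mult norm_power)
  \<comment> \<open>The two estimates are chained through \<open>cmod (poly P 0)\<close>.\<close>
  ultimately have "cmod c * (d * a ^ n) \<le> cmod c * (s * b ^ n)"
    by (simp add: mult_ac)
  with c show ?thesis
    by (simp add: n_def)
qed

lemma spectrum_separation_ge:
  assumes "0 < a" "a < b" "r \<in> ratfuns m k"
  shows "ennreal ((a / b) ^ k) \<le> spectrum_separation {z. cmod z \<ge> b} {z. cmod z \<le> a} r"
proof -
  define S where "S = (SUP z\<in>{z. cmod z \<ge> b}. ratfun_cmod r z)"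
  define D where "D = (INF z\<in>{z. cmod z \<le> a}. ratfun_cmod r z)"
  have sep: "spectrum_separation {z. cmod z \<ge> b} {z. cmod z \<le> a} r
      = (if S = \<infinity> \<or> D = 0 then \<infinity> else S / D)"
    unfolding spectrum_separation_def S_def D_def Let_def by (rule refl)
  show ?thesis
  proof (cases "S = \<infinity> \<or> D = 0")
    case False
    obtain P Q where eq: "quot_of_fract r = (P, Q)"
      by force
    define n where "n = degree Q"
    have n: "n \<le> k"
      using degree_snd_quot_of_fract_ratfuns[OF assms(3)] by (simp add: eq n_def)
    have cop: "coprime P Q"
      using coprime_quot_of_fract[of r] by (simp add: eq)
    have cmod_r: "ratfun_cmod r z = (if poly Q z = 0 then \<infinity> else ennreal (cmod (poly P z / poly Q z)))" for z
      by (simp add: ratfun_cmod_def eq)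
    obtain s where s: "S = ennreal s" "s \<ge> 0"
      using False by (cases S) auto
    have outer: "poly Q z \<noteq> 0 \<and> cmod (poly P z) \<le> s * cmod (poly Q z)" if "cmod z \<ge> b" for z
    proof -
      have le: "ratfun_cmod r z \<le> ennreal s"
        using that unfolding s(1)[symmetric] S_def by (intro SUP_upper) simp
      then have "poly Q z \<noteq> 0"
        by (auto simp: cmod_r top_unique split: if_splits)
      with le s show ?thesis
        by (auto simp: cmod_r norm_divide divide_simps)
    qed
    \<comment> \<open>Stated for every finite \<open>d\<close> below \<open>D\<close>, because
      \<open>D\<close> is not yet known to be finite; this bound is what excludes
      \<open>D = \<infinity>\<close>.\<close>
    have bound: "d \<le> s * (b / a) ^ k" if d: "d > 0" "ennreal d \<le> D" for d
    proof -
      have inner: "d * cmod (poly Q z) \<le> cmod (poly P z)" if "cmod z \<le> a" for z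
      proof (cases "poly Q z = 0")
        case False
        have "ennreal d \<le> ratfun_cmod r z"
          using d(2) that unfolding D_def by (auto simp: le_INF_iff)
        with False show ?thesis
          by (simp add: cmod_r norm_divide field_simps)
      qed simp
      \<comment> \<open>By \<open>inner\<close>, a zero of \<open>P\<close> here would be a zero of
        \<open>Q\<close> too, against coprimality.\<close>
      have P_nz: "poly P z \<noteq> 0" if "cmod z \<le> a" for z
        using coprime_poly_no_common_root[OF cop, of z] inner[OF that] d(1)
        by (auto simp: mult_le_0_iff)
      have "d * a ^ n \<le> s * b ^ n"
        unfolding n_def
        by (rule annulus_ratio_bound[OF assms(1) _ _ P_nz inner]) (use outer assms d in auto)
      then have "d \<le> s * (b / a) ^ n"
        using assms by (simp add: field_simps power_divide)
      also have "\<dots> \<le> s * (b / a) ^ k"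
        using s assms n by (intro mult_left_mono power_increasing) auto
      finally show ?thesis .
    qed
    have "D \<noteq> \<infinity>"
    proof
      assume "D = \<infinity>"
      then show False
        using bound[of "s * (b / a) ^ k + 1"] s assms by (auto simp: add_nonneg_pos)
    qed
    then obtain d where d: "D = ennreal d" "d > 0"
      using False by (cases D) (auto simp: less_le)
    have "(a / b) ^ k \<le> s / d"
      using bound[of d] d assms by (simp add: field_simps power_divide)
    then have "ennreal ((a / b) ^ k) \<le> S / D"
      using s d by (simp add: divide_ennreal ennreal_leI)
    with False show ?thesis
      by (simp add: sep)
  qed (auto simp: sep)
qed

section \<open>Comparison of the quadrature with the Zolotarev number\<close>

lemma zolotarev_ge:
  assumes "0 < a" "a < b"
  shows "ennreal ((a / b) ^ k) \<le> zolotarev k {z. cmod z \<ge> b} {z. cmod z \<le> a}"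
  unfolding zolotarev_def using spectrum_separation_ge[OF assms] by (intro INF_greatest) auto

lemma zolotarev_le_trapz:
  assumes "0 < a" "k > 0"
  shows "zolotarev k Out Inn \<le> spectrum_separation Out Inn (trapz_ratfun 0 a k)"
  unfolding zolotarev_def
proof (rule INF_lower)
  have "trapz_ratfun 0 a k = to_fract 1 / to_fract (trapz_denom a k)"
    using assms by (simp add: trapz_ratfun_centered)
  moreover have "degree (1 :: complex poly) \<le> k"
    by simp
  ultimately have "trapz_ratfun 0 a k \<in> ratfuns k k"
    using trapz_denom_nonzero[OF assms(2), of a] degree_trapz_denom[of a k]
    unfolding ratfuns_def by blast
  moreover have "trapz_ratfun 0 a k \<noteq> 0"
    using assms trapz_denom_nonzero[OF assms(2), of a] by (simp add: trapz_ratfun_centered)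
  ultimately show "trapz_ratfun 0 a k \<in> ratfuns k k - {0}"
    by simp
qed

theorem corollary4p5:
  fixes a b :: real and Inn Out :: "complex set"
  assumes "0 < a" and "a < b"
    and "Inn = {z. cmod z \<le> a}"
    and "Out = {z. cmod z \<ge> b}"
  shows "(\<forall>k>0.
            trapz_ratfun 0 a k = 1 / (1 + (ratfun_var / ratfun_const (complex_of_real a)) ^ k) \<and>
            spectrum_separation Out Inn (trapz_ratfun 0 a k) = ennreal (2 / ((b / a) ^ k - 1))) \<and>
         (\<lambda>k. enn2real (spectrum_separation Out Inn (trapz_ratfun 0 a k)))
           \<in> \<Theta>(\<lambda>k. enn2real (zolotarev k Out Inn))"
proof (intro conjI allI impI)
  fix k :: nat assume "k > 0"
  then show "trapz_ratfun 0 a k = 1 / (1 + (ratfun_var / ratfun_const (complex_of_real a)) ^ k)"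
    using assms(1) by (simp add: trapz_ratfun_centered to_fract_trapz_denom)
next
  fix k :: nat assume "k > 0"
  then show "spectrum_separation Out Inn (trapz_ratfun 0 a k) = ennreal (2 / ((b / a) ^ k - 1))"
    using assms by (simp add: spectrum_separation_trapz)
next
  define T where "T k = enn2real (spectrum_separation Out Inn (trapz_ratfun 0 a k))" for k
  define Z where "Z k = enn2real (zolotarev k Out Inn)" for k
  \<comment> \<open>With \<open>t = (a / b) ^ k\<close>, the separation is
    \<open>2 * t / (1 - t)\<close>; here \<open>t \<le> a / b\<close> as \<open>k > 0\<close>, and
    \<open>t\<close> is at most the Zolotarev number.\<close>
  define C where "C = 2 / (1 - a / b)"
  have bounds: "Z k \<le> T k" "T k \<le> C * Z k" if "k > 0" for k
  proof -
    have sep: "spectrum_separation Out Inn (trapz_ratfun 0 a k) = ennreal (2 / ((b / a) ^ k - 1))"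
      using assms that by (simp add: spectrum_separation_trapz)
    have le: "zolotarev k Out Inn \<le> ennreal (2 / ((b / a) ^ k - 1))"
      using zolotarev_le_trapz[OF assms(1) that, of Out Inn] by (simp only: sep)
    then show "Z k \<le> T k"
      by (simp add: Z_def T_def sep enn2real_mono)
    have B: "(b / a) ^ k > 1"
      using assms that by simp
    have "ennreal ((a / b) ^ k) \<le> zolotarev k Out Inn"
      using zolotarev_ge[OF assms(1,2)] by (simp add: assms)
    \<comment> \<open>The upper bound \<open>le\<close> makes the Zolotarev number finite, so that
      \<open>enn2real\<close> does not send it from infinity to 0.\<close>
    then have "(a / b) ^ k \<le> Z k"
      using le assms unfolding Z_def
      by (metis enn2real_ennreal enn2real_mono ennreal_less_top le_less_trans
          divide_nonneg_nonneg less_imp_le order.trans zero_le_power)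
    moreover have "(a / b) ^ k \<le> a / b"
      using assms that power_decreasing[of 1 k "a / b"] by simp
    moreover have "T k = 2 / ((b / a) ^ k - 1)"
      using B by (simp add: T_def sep)
    then have "T k = 2 * (a / b) ^ k / (1 - (a / b) ^ k)"
      using B assms(1,2) by (simp add: power_divide divide_simps)
    ultimately show "T k \<le> C * Z k"
      using assms by (auto simp: C_def Z_def intro!: frac_le)
  qed
  have "T \<in> O(Z)"
    using bounds(2) by (intro bigoI[of _ C] eventually_mono[OF eventually_gt_at_top[of 0]])
      (auto simp: T_def Z_def)
  moreover have "Z \<in> O(T)"
    using bounds(1) by (intro bigoI[of _ 1] eventually_mono[OF eventually_gt_at_top[of 0]])
      (auto simp: T_def Z_def)
  ultimately have "T \<in> \<Theta>(Z)"
    by (simp add: bigtheta_def bigomega_iff_bigo)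
  then show "(\<lambda>k. enn2real (spectrum_separation Out Inn (trapz_ratfun 0 a k)))
           \<in> \<Theta>(\<lambda>k. enn2real (zolotarev k Out Inn))"
    by (simp only: T_def[abs_def] Z_def[abs_def])
qed

end
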